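(* Let $M\ge 0$ be an integer, $r>0$, and let $f_M(x)=\sum_{m=0}^M a_m P_m\left(\frac{x}{r+1}\right)$ with $a_0,\dots,a_M\in\mathbb{R}$. For integers $m,n\ge 0$ let $R_{m,n}$ be the coefficient of $P_m(x/r)$ in the Legendre expansion of $$\tilde R_n(x)=\int_{-1}^{1} f_M(x-t)P_n(t)\,\mathrm{d}t=\sum_{m=0}^{M}R_{m,n}P_m\left(\frac{x}{r}\right),\qquad x\in[-r,r],$$ with $R_{m,n}=0$ for $m>M$. Then for all integers $m,n\ge 1$ the following four identities hold: $$R_{m,n+1}=R_{m,n-1}+r(2n+1)\left(\frac{R_{m-1,n}}{2m-1}-\frac{R_{m+1,n}}{2m+3}\right),$$ $$R_{m+1,n}=\frac{2m+3}{2m-1}R_{m-1,n}-\frac{1}{r}\,\frac{2m+3}{2n+1}\left(R_{m,n+1}-R_{m,n-1}\right),$$ $$R_{m,n-1}=R_{m,n+1}-r(2n+1)\left(\frac{R_{m-1,n}}{2m-1}-\frac{R_{m+1,n}}{2m+3}\right),$$ $$R_{m-1,n}=\frac{2m-1}{2m+3}R_{m+1,n}+\frac{1}{r}\,\frac{2m-1}{2n+1}\left(R_{m,n+1}-R_{m,n-1}\right).$$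
   Context: $P_m$ denotes the Legendre polynomial of degree $m$ (standard normalization $P_m(1)=1$). For each $n\ge 0$, $\tilde R_n$ is a polynomial in $x$ of degree at most $M$, so the coefficients $R_{m,n}$ are well defined; the matrix $(R_{m,n})$ represents, in Legendre bases, the Fredholm convolution operator $g\mapsto \int_{-1}^1 f_M(x-t)g(t)\,\mathrm{d}t$. *)

theory Defs
  imports "HOL-Analysis.Analysis" "HOL-Computational_Algebra.Polynomial"
begin

text \<open>Legendre polynomials via Bonnet's recursion
  \<open>(n + 2) P\<^sub>n\<^sub>+\<^sub>2 = (2n + 3) x P\<^sub>n\<^sub>+\<^sub>1 - (n + 1) P\<^sub>n\<close>. The lemmas below show that this is the
  sequence of polynomials of degree \<open>n\<close>, orthogonal on \<open>[-1, 1]\<close>, with value \<open>1\<close> at \<open>1\<close>.\<close>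

fun legendre :: "nat \<Rightarrow> real poly" where
  "legendre 0 = 1"
| "legendre (Suc 0) = [:0, 1:]"
| "legendre (Suc (Suc n)) =
     smult (1 / real (n + 2))
       (smult (real (2 * n + 3)) ([:0, 1:] * legendre (Suc n)) - smult (real (n + 1)) (legendre n))"

definition conv_kernel :: "nat \<Rightarrow> real \<Rightarrow> (nat \<Rightarrow> real) \<Rightarrow> real \<Rightarrow> real" where
  "conv_kernel M r a x = (\<Sum>m\<le>M. a m * poly (legendre m) (x / (r + 1)))"

definition conv_legendre :: "nat \<Rightarrow> real \<Rightarrow> (nat \<Rightarrow> real) \<Rightarrow> nat \<Rightarrow> real \<Rightarrow> real" where
  "conv_legendre M r a n x =
     integral {-1..1} (\<lambda>t. conv_kernel M r a (x - t) * poly (legendre n) t)"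

definition is_legendre_expansion :: "nat \<Rightarrow> real \<Rightarrow> (real \<Rightarrow> real) \<Rightarrow> (nat \<Rightarrow> real) \<Rightarrow> bool" where
  "is_legendre_expansion M r g c \<longleftrightarrow>
     (\<forall>x\<in>{-r..r}. g x = (\<Sum>m\<le>M. c m * poly (legendre m) (x / r))) \<and> (\<forall>m>M. c m = 0)"

text \<open>The description is proper for \<open>r > 0\<close>: see \<open>conv_matrix_welldefined\<close> below.\<close>

definition conv_matrix :: "nat \<Rightarrow> real \<Rightarrow> (nat \<Rightarrow> real) \<Rightarrow> nat \<Rightarrow> nat \<Rightarrow> real" where
  "conv_matrix M r a m n = (THE c. is_legendre_expansion M r (conv_legendre M r a n) c) m"


lemma poly_legendre_1: "poly (legendre n) 1 = 1"
  by (induction n rule: legendre.induct) (auto simp: field_simps)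

lemma legendre_coeffs_aux:
  "(\<forall>k>n. coeff (legendre n) k = 0) \<and> coeff (legendre n) n > 0"
proof (induction n rule: legendre.induct)
  case (3 n)
  have "coeff (legendre (Suc (Suc n))) k = 0" if "k > Suc (Suc n)" for k
    using that 3 by (cases k) auto
  moreover have "coeff (legendre (Suc (Suc n))) (Suc (Suc n)) > 0"
    using 3 by auto
  ultimately show ?case by blast
qed (auto simp: coeff_eq_0)

lemma degree_legendre: "degree (legendre n) = n"
  using legendre_coeffs_aux[of n]
  by (metis le_antisym le_degree degree_le less_irrefl)

lemma legendre_neq_0: "legendre n \<noteq> 0"
  using legendre_coeffs_aux[of n] by auto

lemma legendre_pderiv_aux:
  "x * poly (pderiv (legendre (Suc n))) x - poly (pderiv (legendre n)) x
     = real (n + 1) * poly (legendre (Suc n)) x \<and>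
   poly (pderiv (legendre (Suc n))) x - x * poly (pderiv (legendre n)) x
     = real (n + 1) * poly (legendre n) x"
proof (induction n)
  case 0
  show ?case by (simp add: pderiv_pCons)
next
  case (Suc n)
  define p q s where "p = poly (legendre n) x" and "q = poly (legendre (Suc n)) x"
    and "s = poly (legendre (Suc (Suc n))) x"
  define p' q' s' where "p' = poly (pderiv (legendre n)) x"
    and "q' = poly (pderiv (legendre (Suc n))) x"
    and "s' = poly (pderiv (legendre (Suc (Suc n)))) x"
  define N where "N = real n"
  have N: "N + 2 \<noteq> 0" by (simp add: N_def)
  have s: "(N + 2) * s = (2 * N + 3) * (x * q) - (N + 1) * p"
    using N by (simp add: s_def p_def q_def N_def field_simps)
  have s': "(N + 2) * s' = (2 * N + 3) * (q + x * q') - (N + 1) * p'"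
    using N by (simp add: s'_def p'_def q'_def q_def N_def pderiv_smult pderiv_diff pderiv_mult
        pderiv_pCons field_simps)
  have IH: "x * q' - p' = (N + 1) * q" "q' - x * p' = (N + 1) * p"
    using Suc unfolding p_def q_def p'_def q'_def N_def of_nat_add of_nat_1 by blast+
  have "(N + 2) * (s' - x * q') = (2 * N + 3) * q + (N + 1) * (x * q' - p')"
    using s' by (simp add: algebra_simps)
  also have "\<dots> = (N + 2) * ((N + 2) * q)"
    unfolding IH by (simp add: algebra_simps)
  finally have B: "s' - x * q' = (N + 2) * q"
    using N by simp
  have C: "x * (x * q') - q' = (N + 1) * (x * q - p)"
  proof -
    have "x * (x * q') - q' = x * (x * q' - p') - (q' - x * p')"
      by (simp add: algebra_simps)
    also have "\<dots> = (N + 1) * (x * q - p)" unfolding IH by (simp add: algebra_simps)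
    finally show ?thesis .
  qed
  have "x * s' - q' = x * (s' - x * q') + (x * (x * q') - q')"
    by (simp add: algebra_simps)
  also have "\<dots> = (N + 2) * s" unfolding B C s by (simp add: algebra_simps)
  finally show ?case
    using B by (simp add: s_def q_def s'_def q'_def N_def del: legendre.simps)
qed

lemma legendre_ode:
  "pderiv ([:1, 0, -1:] * pderiv (legendre n)) = - smult (real n * (real n + 1)) (legendre n)"
proof (cases n)
  case 0
  then show ?thesis by simp
next
  case (Suc k)
  have "[:1, 0, -1:] * pderiv (legendre (Suc k))
      = smult (real (k + 1)) (legendre k - [:0, 1:] * legendre (Suc k))"
  proof (rule poly_ext)
    fix x
    show "poly ([:1, 0, -1:] * pderiv (legendre (Suc k))) x =
      poly (smult (real (k + 1)) (legendre k - [:0, 1:] * legendre (Suc k))) x"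
      using legendre_pderiv_aux[of x k] by (simp del: legendre.simps) algebra
  qed
  moreover have "pderiv (smult (real (k + 1)) (legendre k - [:0, 1:] * legendre (Suc k)))
      = - smult (real n * (real n + 1)) (legendre n)"
  proof (rule poly_ext)
    fix x
    show "poly (pderiv (smult (real (k + 1)) (legendre k - [:0, 1:] * legendre (Suc k)))) x =
      poly (- smult (real n * (real n + 1)) (legendre n)) x"
      using legendre_pderiv_aux[of x k] unfolding Suc
      by (simp add: pderiv_smult pderiv_diff pderiv_mult pderiv_pCons del: legendre.simps) algebra
  qed
  ultimately show ?thesis by (simp add: Suc del: legendre.simps)
qed

lemma legendre_orthogonal:
  assumes "m \<noteq> n"
  shows "integral {-1..1} (\<lambda>t. poly (legendre m) t * poly (legendre n) t) = 0"
proof -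
  define A where "A = (\<lambda>k. [:1, 0, -1:] * pderiv (legendre k))"
  define q where "q = legendre n * A m - legendre m * A n"
  define d where "d = real n * (real n + 1) - real m * (real m + 1)"
  have d: "d \<noteq> 0"
  proof -
    have "d = (real n - real m) * (real n + real m + 1)" by (simp add: d_def algebra_simps)
    moreover have "real n + real m + 1 \<noteq> 0" by linarith
    ultimately show ?thesis using assms by simp
  qed
  have A': "pderiv (A k) = - smult (real k * (real k + 1)) (legendre k)" for k
    unfolding A_def by (rule legendre_ode)
  have q': "poly (pderiv q) t = d * (poly (legendre m) t * poly (legendre n) t)" for t
  proof -
    have "poly (A m) t * poly (pderiv (legendre n)) t = poly (A n) t * poly (pderiv (legendre m)) t"
      by (simp add: A_def algebra_simps)
    then show ?thesis
      by (simp add: q_def pderiv_diff pderiv_mult A' d_def algebra_simps)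
  qed
  have "((\<lambda>t. poly (pderiv q) t) has_integral (poly q 1 - poly q (-1))) {-1..1}"
    by (rule fundamental_theorem_of_calculus)
      (auto simp flip: has_real_derivative_iff_has_vector_derivative
        intro!: DERIV_subset[OF poly_DERIV])
  moreover have "poly q 1 - poly q (-1) = 0"
    by (simp add: q_def A_def)
  ultimately have "integral {-1..1} (\<lambda>t. d * (poly (legendre m) t * poly (legendre n) t)) = 0"
    unfolding q' using integral_unique by (metis (no_types, lifting))
  then show ?thesis using d by simp
qed

lemma legendre_expand:
  fixes p :: "real poly"
  assumes "degree p \<le> M"
  shows "\<exists>c. p = (\<Sum>m\<le>M. smult (c m) (legendre m)) \<and> (\<forall>m>M. c m = 0)"
  using assms
proof (induction M arbitrary: p)
  case 0
  then obtain b where "p = [:b:]" by (metis degree_eq_zeroE le_0_eq)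
  then show ?case by (intro exI[of _ "\<lambda>m. if m = 0 then b else 0"]) simp
next
  case (Suc M)
  define b where "b = coeff p (Suc M) / coeff (legendre (Suc M)) (Suc M)"
  define q where "q = p - smult b (legendre (Suc M))"
  have "coeff q k = 0" if "k > M" for k
  proof (cases "k = Suc M")
    case True
    then show ?thesis using legendre_coeffs_aux[of "Suc M"] by (simp add: q_def b_def)
  next
    case False
    then have "k > Suc M" using that by simp
    then show ?thesis using legendre_coeffs_aux[of "Suc M"] Suc.prems
      by (simp add: q_def coeff_eq_0 del: legendre.simps)
  qed
  then have "degree q \<le> M" by (simp add: degree_le)
  from Suc.IH[OF this] obtain c where c: "q = (\<Sum>m\<le>M. smult (c m) (legendre m))"
    "\<forall>m>M. c m = 0" by blast
  have "p = q + smult b (legendre (Suc M))" by (simp add: q_def)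
  also have "\<dots> = (\<Sum>m\<le>Suc M. smult ((c(Suc M := b)) m) (legendre m))"
    by (simp add: c(1) del: legendre.simps)
  finally show ?case using c(2) by (intro exI[of _ "c(Suc M := b)"]) auto
qed

lemma legendre_independent:
  assumes "(\<Sum>m\<le>M. smult (c m) (legendre m)) = 0" "m \<le> M"
  shows "c m = 0"
  using assms
proof (induction M)
  case (Suc M)
  have "coeff (\<Sum>m\<le>M. smult (c m) (legendre m)) (Suc M) = 0"
    using legendre_coeffs_aux by (simp add: coeff_sum del: legendre.simps)
  moreover have "coeff (\<Sum>m\<le>Suc M. smult (c m) (legendre m)) (Suc M) = 0"
    using Suc.prems by simp
  ultimately have "c (Suc M) * coeff (legendre (Suc M)) (Suc M) = 0"
    by (simp del: legendre.simps)
  then have c: "c (Suc M) = 0" using legendre_coeffs_aux[of "Suc M"] by simp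
  show ?case
  proof (cases "m = Suc M")
    case False
    then show ?thesis using Suc c by simp
  qed (use c in simp)
qed simp

lemma is_legendre_expansion_unique:
  assumes "r > 0" "is_legendre_expansion M r g c" "is_legendre_expansion M r g d"
  shows "c = d"
proof
  fix m
  define p where "p = (\<Sum>m\<le>M. smult (c m - d m) (legendre m))"
  have "poly p y = 0" if "y \<in> {-1..1}" for y
  proof -
    have "r * y \<in> {-r..r}" using that assms(1)
      using mult_left_mono[of "-1" y r] mult_left_mono[of y 1 r] by auto
    then have "(\<Sum>m\<le>M. c m * poly (legendre m) (r * y / r)) = (\<Sum>m\<le>M. d m * poly (legendre m) (r * y / r))"
      using assms(2,3) unfolding is_legendre_expansion_def by metis
    then show ?thesis using assms(1)
      by (simp add: p_def poly_sum left_diff_distrib sum_subtractf)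
  qed
  then have "{-1..1} \<subseteq> {y. poly p y = 0}" by auto
  moreover have "infinite {-1..1::real}" by (simp add: infinite_Icc)
  ultimately have "p = 0" using poly_roots_finite infinite_super by blast
  then show "c m = d m"
    using legendre_independent[of "\<lambda>m. c m - d m" M m] assms(2,3)
    unfolding p_def is_legendre_expansion_def by (cases "m \<le> M") auto
qed

lemma conv_monomial_poly:
  fixes q :: "real poly"
  shows "\<exists>p::real poly. degree p \<le> k \<and>
     (\<forall>x. integral {-1..1} (\<lambda>t. (x - t) ^ k * poly q t) = poly p x)"
proof -
  define I where "I = (\<lambda>i. integral {-1..1} (\<lambda>t. (- t) ^ (k - i) * poly q t))"
  define p where "p = (\<Sum>i\<le>k. monom (real (k choose i) * I i) i)"
  have "degree p \<le> k" unfolding p_def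
    by (intro degree_sum_le) (auto intro: order_trans[OF degree_monom_le])
  moreover have "integral {-1..1} (\<lambda>t. (x - t) ^ k * poly q t) = poly p x" for x
  proof -
    have "(\<lambda>t. (x - t) ^ k * poly q t)
        = (\<lambda>t. \<Sum>i\<le>k. (real (k choose i) * x ^ i) * ((- t) ^ (k - i) * poly q t))"
    proof
      fix t
      have "(x - t) ^ k = (x + (- t)) ^ k" by simp
      then show "(x - t) ^ k * poly q t
        = (\<Sum>i\<le>k. (real (k choose i) * x ^ i) * ((- t) ^ (k - i) * poly q t))"
        unfolding binomial_ring by (simp add: sum_distrib_right mult.assoc)
    qed
    moreover have "integral {-1..1}
          (\<lambda>t. \<Sum>i\<le>k. (real (k choose i) * x ^ i) * ((- t) ^ (k - i) * poly q t))
        = (\<Sum>i\<le>k. (real (k choose i) * x ^ i) * I i)"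
      by (subst integral_sum)
        (auto simp: I_def intro!: integrable_continuous_interval continuous_intros)
    ultimately show ?thesis
      by (simp add: p_def poly_sum poly_monom mult_ac)
  qed
  ultimately show ?thesis by blast
qed

lemma conv_legendre_poly:
  "\<exists>p. degree p \<le> M \<and> (\<forall>x. conv_legendre M r a n x = poly p x)"
proof -
  define F where "F = pcompose (\<Sum>m\<le>M. smult (a m) (legendre m)) [:0, 1 / (r + 1):]"
  have F: "conv_kernel M r a x = poly F x" for x
    by (simp add: conv_kernel_def F_def poly_pcompose poly_sum)
  have "degree (\<Sum>m\<le>M. smult (a m) (legendre m)) \<le> M"
    by (intro degree_sum_le) (auto simp: degree_legendre)
  then have degF: "degree F \<le> M"
    unfolding F_def by (simp add: degree_pcompose)
  obtain p where p: "\<And>k. degree (p k) \<le> k"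
    "\<And>k x. integral {-1..1} (\<lambda>t. (x - t) ^ k * poly (legendre n) t) = poly (p k) x"
    using conv_monomial_poly[of _ "legendre n"] by metis
  define P where "P = (\<Sum>k\<le>degree F. smult (coeff F k) (p k))"
  have "degree P \<le> M" unfolding P_def
    using degF by (intro degree_sum_le) (auto intro: order_trans[OF degree_smult_le] order_trans[OF p(1)])
  moreover have "conv_legendre M r a n x = poly P x" for x
  proof -
    have "conv_legendre M r a n x = integral {-1..1}
        (\<lambda>t. \<Sum>k\<le>degree F. coeff F k * ((x - t) ^ k * poly (legendre n) t))"
      unfolding conv_legendre_def F by (simp add: poly_altdef[of F] sum_distrib_right mult.assoc)
    also have "\<dots> = (\<Sum>k\<le>degree F. coeff F k * poly (p k) x)"
      by (subst integral_sum)
        (auto simp: p(2) intro!: integrable_continuous_interval continuous_intros)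
    finally show ?thesis by (simp add: P_def poly_sum)
  qed
  ultimately show ?thesis by blast
qed

lemma conv_matrix_welldefined:
  assumes "r > 0"
  shows "\<exists>!c. is_legendre_expansion M r (conv_legendre M r a n) c"
proof -
  obtain p where p: "degree p \<le> M" "\<And>x. conv_legendre M r a n x = poly p x"
    using conv_legendre_poly by blast
  have "degree (pcompose p [:0, r:]) \<le> M" using p(1) by (simp add: degree_pcompose)
  from legendre_expand[OF this] obtain c where
    c: "pcompose p [:0, r:] = (\<Sum>m\<le>M. smult (c m) (legendre m))" "\<forall>m>M. c m = 0" by blast
  have "conv_legendre M r a n x = (\<Sum>m\<le>M. c m * poly (legendre m) (x / r))" for x
  proof -
    have "poly p x = poly (pcompose p [:0, r:]) (x / r)"
      using assms by (simp add: poly_pcompose)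
    then show ?thesis unfolding c p by (simp add: poly_sum)
  qed
  then have "is_legendre_expansion M r (conv_legendre M r a n) c"
    using c(2) by (simp add: is_legendre_expansion_def)
  then show ?thesis using is_legendre_expansion_unique[OF assms] by blast
qed

lemma conv_matrix_expansion:
  assumes "r > 0"
  shows "is_legendre_expansion M r (conv_legendre M r a n) (\<lambda>m. conv_matrix M r a m n)"
  unfolding conv_matrix_def using theI'[OF conv_matrix_welldefined[OF assms]] by simp

end

theory Submission
  imports Defs
begin

text \<open>Since \<open>(2n + 1) P\<^sub>n = (P\<^sub>n\<^sub>+\<^sub>1 - P\<^sub>n\<^sub>-\<^sub>1)'\<close> and \<open>P\<^sub>n\<^sub>+\<^sub>1 - P\<^sub>n\<^sub>-\<^sub>1\<close> vanishes at \<open>-1\<close> and \<open>1\<close>,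
  integration by parts moves the derivative onto the kernel: the convolution with \<open>P\<^sub>n\<^sub>+\<^sub>1 - P\<^sub>n\<^sub>-\<^sub>1\<close>
  has derivative \<open>2n + 1\<close> times the convolution with \<open>P\<^sub>n\<close>. Integrating the Legendre expansion of
  the latter term by term, again with the formula for \<open>P\<^sub>m\<close>, and comparing coefficients gives the first
  identity; the others are rearrangements of it.\<close>

text \<open>Adding the first identity of \<open>legendre_pderiv_aux\<close> at \<open>n\<close> to
  the second at \<open>Suc n\<close> cancels the terms \<open>x * P'\<close> of index
  \<open>Suc n\<close>.\<close>

lemma legendre_pderiv_diff:
  "pderiv (legendre (Suc (Suc n))) - pderiv (legendre n)
     = smult (2 * real n + 3) (legendre (Suc n))"
proof (rule poly_ext)
  fix x
  show "poly (pderiv (legendre (Suc (Suc n))) - pderiv (legendre n)) x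
      = poly (smult (2 * real n + 3) (legendre (Suc n))) x"
    using conjunct1[OF legendre_pderiv_aux[of x n]] conjunct2[OF legendre_pderiv_aux[of x "Suc n"]]
    by (simp add: algebra_simps del: legendre.simps)
qed

lemma poly_legendre_minus_1: "poly (legendre n) (-1) = (-1) ^ n"
  by (induction n rule: legendre.induct) (auto simp: field_simps)

text \<open>The sum is a constant \<open>k\<close>; as \<open>legendre 0 = 1\<close>, lowering only
  \<open>c 0\<close> by \<open>k\<close> makes it 0, and linear independence applies.\<close>

lemma legendre_coeff_eq_0_of_pderiv:
  assumes "pderiv (\<Sum>m\<le>N. smult (c m) (legendre m)) = 0" "1 \<le> m" "m \<le> N"
  shows "c m = 0"
proof -
  obtain k where k: "(\<Sum>m\<le>N. smult (c m) (legendre m)) = [:k:]"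
    using assms(1) pderiv_iszero by blast
  have "(\<Sum>m\<le>N. smult ((c(0 := c 0 - k)) m) (legendre m))
      = (\<Sum>m\<le>N. smult (c m) (legendre m) - (if m = 0 then [:k:] else 0))"
    by (intro sum.cong) (auto simp: smult_diff_left)
  also have "\<dots> = 0"
    by (simp add: sum_subtractf k)
  finally show ?thesis
    using legendre_independent[of "c(0 := c 0 - k)" N m] assms(2,3) by simp
qed

text \<open>The last two terms are the boundary terms of the telescoping sum.\<close>
lemma pderiv_legendre_antiderivative:
  fixes b :: "nat \<Rightarrow> real"
  shows "pderiv (\<Sum>m\<le>Suc N. smult (if m = 0 then 0
        else b (m - 1) / (2 * real m - 1) - b (m + 1) / (2 * real m + 3)) (legendre m))
    = (\<Sum>k\<le>N. smult (b k) (legendre k))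
      - smult (b (N + 1) / (2 * real N + 3)) (pderiv (legendre N))
      - smult (b (N + 2) / (2 * real N + 5)) (pderiv (legendre (Suc N)))"
proof (induction N)
  case 0
  show ?case by (simp add: pderiv_smult pderiv_pCons numeral_2_eq_2)
next
  case (Suc N)
  have "pderiv (legendre (Suc (Suc N)))
      = pderiv (legendre N) + smult (2 * real N + 3) (legendre (Suc N))"
    using legendre_pderiv_diff[of N] by (simp add: algebra_simps del: legendre.simps)
  \<comment> \<open>The first summand cancels a boundary term of the induction hypothesis; the
    second extends the Legendre sum to index \<open>Suc N\<close>.\<close>
  then have step: "smult (b (N + 1) / (2 * real N + 3)) (pderiv (legendre (Suc (Suc N))))
      = smult (b (N + 1) / (2 * real N + 3)) (pderiv (legendre N))
        + smult (b (Suc N)) (legendre (Suc N))"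
    using of_nat_0_le_iff[of N, where ?'a = real]
    by (simp add: smult_add_right add_nonneg_eq_0_iff del: legendre.simps)
  show ?case
    unfolding sum.atMost_Suc[of _ "Suc N"] pderiv_add Suc.IH
    using step by (simp add: pderiv_smult pderiv_diff smult_diff_left algebra_simps del: legendre.simps)
qed

lemma has_derivative_poly_convolution:
  fixes F G :: "real poly"
  shows "((\<lambda>x. integral {-1..1} (\<lambda>t. poly F (x - t) * poly G t)) has_real_derivative
    integral {-1..1} (\<lambda>t. poly (pderiv F) (x - t) * poly G t)) (at x)"
proof -
  have "((\<lambda>x. integral (cbox (-1) 1) (\<lambda>t. poly F (x - t) * poly G t)) has_field_derivative
    integral (cbox (-1) 1) (\<lambda>t. poly (pderiv F) (x - t) * poly G t)) (at x within UNIV)"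
    by (rule leibniz_rule_field_derivative)
      (auto intro!: derivative_eq_intros integrable_continuous_interval continuous_intros
        simp: split_beta)
  then show ?thesis by simp
qed

text \<open>The inner derivative of \<open>x - t\<close> is -1, so the usual minus sign of
  integration by parts disappears.\<close>

lemma poly_convolution_by_parts:
  fixes F W :: "real poly"
  assumes "poly W 1 = 0" "poly W (-1) = 0"
  shows "integral {-1..1} (\<lambda>t. poly F (x - t) * poly (pderiv W) t)
    = integral {-1..1} (\<lambda>t. poly (pderiv F) (x - t) * poly W t)"
proof -
  have "((\<lambda>t. poly F (x - t) * poly (pderiv W) t - poly (pderiv F) (x - t) * poly W t)
      has_integral (poly F (x - 1) * poly W 1 - poly F (x - (-1)) * poly W (-1))) {-1..1}"
    by (rule fundamental_theorem_of_calculus)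
      (auto simp flip: has_real_derivative_iff_has_vector_derivative
        intro!: derivative_eq_intros)
  then have "integral {-1..1}
      (\<lambda>t. poly F (x - t) * poly (pderiv W) t - poly (pderiv F) (x - t) * poly W t) = 0"
    using assms by (simp add: integral_unique)
  then show ?thesis
    by (subst (asm) integral_diff)
      (auto intro!: integrable_continuous_interval continuous_intros)
qed

lemma conv_kernel_eq_poly:
  obtains F where "\<And>x. conv_kernel M r a x = poly F x"
proof
  show "conv_kernel M r a x
      = poly (pcompose (\<Sum>m\<le>M. smult (a m) (legendre m)) [:0, 1 / (r + 1):]) x" for x
    by (simp add: conv_kernel_def poly_pcompose poly_sum)
qed

lemma has_derivative_conv_legendre_diff:
  "((\<lambda>x. conv_legendre M r a (Suc (Suc n)) x - conv_legendre M r a n x) has_real_derivative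
     (2 * real n + 3) * conv_legendre M r a (Suc n) x) (at x)"
proof -
  obtain F where F: "\<And>x. conv_kernel M r a x = poly F x"
    using conv_kernel_eq_poly by blast
  define W where "W = legendre (Suc (Suc n)) - legendre n"
  \<comment> \<open>The indices differ by 2, so the values at -1 agree by parity.\<close>
  have W1: "poly W 1 = 0" "poly W (-1) = 0"
    unfolding W_def by (simp_all add: poly_legendre_1 poly_legendre_minus_1 del: legendre.simps)
  have W': "pderiv W = smult (2 * real n + 3) (legendre (Suc n))"
    unfolding W_def pderiv_diff by (rule legendre_pderiv_diff)
  have "conv_legendre M r a (Suc (Suc n)) x - conv_legendre M r a n x
      = integral {-1..1} (\<lambda>t. poly F (x - t) * poly W t)" for x
    unfolding conv_legendre_def F
    by (subst integral_diff[symmetric])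
      (auto simp: W_def algebra_simps simp del: legendre.simps
        intro!: integrable_continuous_interval continuous_intros)
  moreover have "integral {-1..1} (\<lambda>t. poly (pderiv F) (x - t) * poly W t)
      = (2 * real n + 3) * conv_legendre M r a (Suc n) x"
    unfolding poly_convolution_by_parts[OF W1, symmetric] W' conv_legendre_def F
    by (simp add: mult.left_commute[of _ "2 * real n + 3"] del: legendre.simps)
  ultimately show ?thesis
    using has_derivative_poly_convolution[of F W x] by simp
qed

lemma conv_matrix_eq_0: "r > 0 \<Longrightarrow> M < m \<Longrightarrow> conv_matrix M r a m n = 0"
  using conv_matrix_expansion[of r M a n] by (simp add: is_legendre_expansion_def)

text \<open>Substituting \<open>x = r * y\<close> turns the scaled basis \<open>P_m(x/r)\<close>
  into the plain Legendre basis.\<close>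

lemma conv_legendre_eq_sum:
  assumes "r > 0" "y \<in> {-1..1}"
  shows "conv_legendre M r a n (r * y) = (\<Sum>m\<le>M. conv_matrix M r a m n * poly (legendre m) y)"
proof -
  have "r * y \<in> {-r..r}"
    using assms mult_left_mono[of "-1" y r] mult_left_mono[of y 1 r] by auto
  then show ?thesis
    using conv_matrix_expansion[OF assms(1), of M a n] assms(1)
    by (simp add: is_legendre_expansion_def)
qed

lemma pderiv_conv_matrix_diff:
  assumes r: "r > 0"
  shows "pderiv (\<Sum>m\<le>M. smult (conv_matrix M r a m (Suc (Suc n)) - conv_matrix M r a m n) (legendre m))
    = (\<Sum>m\<le>M. smult (r * (2 * real n + 3) * conv_matrix M r a m (Suc n)) (legendre m))"
    (is "pderiv ?s = ?q")
proof -
  have "poly (pderiv ?s) y = poly ?q y" if y: "y \<in> {-1<..<1}" for y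
  proof -
    have "((\<lambda>y. conv_legendre M r a (Suc (Suc n)) (r * y) - conv_legendre M r a n (r * y))
        has_real_derivative (2 * real n + 3) * conv_legendre M r a (Suc n) (r * y) * r) (at y)"
      by (rule DERIV_chain2[OF has_derivative_conv_legendre_diff])
        (auto intro!: derivative_eq_intros)
    \<comment> \<open>The expansions hold only on \<open>[-1, 1]\<close>, so the derivative is
      transferred on its interior. The extra factor \<open>r\<close> comes from the chain
      rule.\<close>
    then have "(poly ?s has_real_derivative
        (2 * real n + 3) * conv_legendre M r a (Suc n) (r * y) * r) (at y)"
      by (rule has_field_derivative_transform_within_open[where S = "{-1<..<1}"])
        (use y in \<open>auto simp: conv_legendre_eq_sum[OF r] poly_sum left_diff_distrib sum_subtractf
          simp del: legendre.simps\<close>)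
    from DERIV_unique[OF poly_DERIV this]
    have "poly (pderiv ?s) y = r * (2 * real n + 3) * conv_legendre M r a (Suc n) (r * y)"
      by (simp only: mult_ac)
    also have "\<dots> = poly ?q y"
      using y by (simp add: conv_legendre_eq_sum[OF r] poly_sum sum_distrib_left mult.assoc
          del: legendre.simps)
    finally show ?thesis .
  qed
  \<comment> \<open>Agreement at infinitely many points gives equality of polynomials.\<close>
  then have "{-1<..<1} \<subseteq> {y. poly (pderiv ?s - ?q) y = 0}" by auto
  moreover have "infinite {-1<..<1::real}" by (simp add: infinite_Ioo)
  ultimately have "pderiv ?s - ?q = 0"
    using poly_roots_finite infinite_super by blast
  then show ?thesis by simp
qed

lemma conv_matrix_recurrence:
  assumes r: "r > 0" and m: "m \<ge> 1"
  shows "conv_matrix M r a m (Suc (Suc n)) - conv_matrix M r a m n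
    = r * (2 * real n + 3) * (conv_matrix M r a (m - 1) (Suc n) / (2 * real m - 1)
        - conv_matrix M r a (m + 1) (Suc n) / (2 * real m + 3))"
proof (cases "m \<le> Suc M")
  \<comment> \<open>Here \<open>m - 1 > M\<close>, so every matrix entry involved is 0.\<close>
  case False
  then show ?thesis using r by (simp add: conv_matrix_eq_0)
next
  case True
  define d where "d m = conv_matrix M r a m (Suc (Suc n)) - conv_matrix M r a m n" for m
  define b where "b m = r * (2 * real n + 3) * conv_matrix M r a m (Suc n)" for m
  \<comment> \<open>These are the coefficients of an antiderivative of the expansion with
    coefficients \<open>b\<close>. The value at 0 is a free constant of integration.\<close>
  define e where "e m = (if m = 0 then 0
    else b (m - 1) / (2 * real m - 1) - b (m + 1) / (2 * real m + 3))" for m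
  \<comment> \<open>Vanishing beyond \<open>M\<close> removes both boundary terms of the
    antiderivative, and lets \<open>d\<close> be summed up to \<open>Suc M\<close>, the range that
    \<open>e\<close> needs.\<close>
  have "b k = 0" "d k = 0" if "k > M" for k
    using that r by (simp_all add: b_def d_def conv_matrix_eq_0)
  then have "pderiv (\<Sum>m\<le>Suc M. smult (e m) (legendre m)) = (\<Sum>k\<le>M. smult (b k) (legendre k))"
    and "(\<Sum>m\<le>Suc M. smult (d m) (legendre m)) = (\<Sum>m\<le>M. smult (d m) (legendre m))"
    unfolding e_def pderiv_legendre_antiderivative by simp_all
  moreover have "pderiv (\<Sum>m\<le>M. smult (d m) (legendre m)) = (\<Sum>k\<le>M. smult (b k) (legendre k))"
    unfolding d_def b_def by (rule pderiv_conv_matrix_diff[OF r])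
  ultimately have "pderiv (\<Sum>m\<le>Suc M. smult (d m - e m) (legendre m)) = 0"
    by (simp only: smult_diff_left sum_subtractf pderiv_diff)
  then have "d m - e m = 0"
    by (rule legendre_coeff_eq_0_of_pderiv[OF _ m True])
  then show ?thesis
    using m by (simp add: d_def e_def b_def right_diff_distrib)
qed

theorem theorem2p3:
  fixes M :: nat and r :: real and a :: "nat \<Rightarrow> real"
  defines "R \<equiv> conv_matrix M r a"
  assumes r_pos: "r > 0"
  shows "\<forall>m\<ge>1. \<forall>n\<ge>1.
    R m (n + 1) = R m (n - 1) + r * (2 * real n + 1)
        * (R (m - 1) n / (2 * real m - 1) - R (m + 1) n / (2 * real m + 3))
    \<and> R (m + 1) n = (2 * real m + 3) / (2 * real m - 1) * R (m - 1) n
        - 1 / r * ((2 * real m + 3) / (2 * real n + 1)) * (R m (n + 1) - R m (n - 1))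
    \<and> R m (n - 1) = R m (n + 1) - r * (2 * real n + 1)
        * (R (m - 1) n / (2 * real m - 1) - R (m + 1) n / (2 * real m + 3))
    \<and> R (m - 1) n = (2 * real m - 1) / (2 * real m + 3) * R (m + 1) n
        + 1 / r * ((2 * real m - 1) / (2 * real n + 1)) * (R m (n + 1) - R m (n - 1))"
proof (intro allI impI)
  fix m n :: nat
  assume m: "m \<ge> 1" and n: "n \<ge> 1"
  define A B C D where "A = R m (n + 1)" and "B = R m (n - 1)"
    and "C = R (m - 1) n" and "D = R (m + 1) n"
  define u v w where "u = 2 * real m - 1" and "v = 2 * real m + 3" and "w = 2 * real n + 1"
  have nz: "u \<noteq> 0" "v \<noteq> 0" "w \<noteq> 0" "r \<noteq> 0"
    using m r_pos unfolding u_def v_def w_def by linarith+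
  \<comment> \<open>The recurrence, stated with indices \<open>n\<close> to \<open>n + 2\<close>, is
    used at \<open>n - 1\<close>; this needs \<open>n \<ge> 1\<close>.\<close>
  have w: "2 * real (n - 1) + 3 = w"
    using n by (simp add: w_def of_nat_diff)
  have AB: "A - B = r * w * (C / u - D / v)"
    using conv_matrix_recurrence[OF r_pos m, of M a "n - 1"] n
    unfolding w A_def B_def C_def D_def R_def u_def v_def by simp
  \<comment> \<open>Once \<open>A - B\<close> is replaced by \<open>AB\<close>, both equations are
    identities in \<open>C\<close> and \<open>D\<close>.\<close>
  have "D = v / u * C - 1 / r * (v / w) * (A - B)" "C = u / v * D + 1 / r * (u / w) * (A - B)"
    unfolding AB using nz by (simp_all add: field_simps)
  moreover have "A = B + r * w * (C / u - D / v)" "B = A - r * w * (C / u - D / v)"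
    using AB by simp_all
  ultimately show "R m (n + 1) = R m (n - 1) + r * (2 * real n + 1)
        * (R (m - 1) n / (2 * real m - 1) - R (m + 1) n / (2 * real m + 3))
    \<and> R (m + 1) n = (2 * real m + 3) / (2 * real m - 1) * R (m - 1) n
        - 1 / r * ((2 * real m + 3) / (2 * real n + 1)) * (R m (n + 1) - R m (n - 1))
    \<and> R m (n - 1) = R m (n + 1) - r * (2 * real n + 1)
        * (R (m - 1) n / (2 * real m - 1) - R (m + 1) n / (2 * real m + 3))
    \<and> R (m - 1) n = (2 * real m - 1) / (2 * real m + 3) * R (m + 1) n
        + 1 / r * ((2 * real m - 1) / (2 * real n + 1)) * (R m (n + 1) - R m (n - 1))"
    unfolding A_def B_def C_def D_def u_def v_def w_def by blast
qed

end
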